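(* Let $X,Y$ be Banach spaces over the same field $\mathbb{K}\in\{\mathbb{R},\mathbb{C}\}$. Let $A:X\times X\to Y$ be a continuous bilinear function and $a$ a real constant such that for all $x_1,x_2\in X$ $$\|A(x_1,x_2)\|_Y\le a\|x_1\|_X\|x_2\|_X,\qquad A(x_1,x_2)=A(x_2,x_1).$$ Let $B:X\to Y$ be a bounded linear operator onto $Y$ and let $b>0$ be a constant such that $$\overline B_Y(0,b)\subseteq B\big(\overline B_X(0,1)\big).$$ Let $C\in Y$ be a fixed element and put $c=\|C\|_Y$. If $D=b^2-4ac\ge 0$, then the equation $$A(x,x)+Bx+C=0$$ has a solution $x\in X$.
   Context: $\overline B_X(\hat x,R)=\{x\in X\mid\|x-\hat x\|_X\le R\}$ denotes the closed ball in $X$, and similarly $\overline B_Y(\hat y,R)$ in $Y$. $B\big(\overline B_X(0,1)\big)$ is the image of the closed unit ball of $X$ under the operator $B$. *)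

theory Defs
  imports "HOL-Analysis.Analysis"
begin

text \<open>
  A Banach space over a field \<open>'k\<close>: the class \<^class>\<open>banach\<close> supplies the norm, completeness and the
  real scalar multiplication, and \<open>scale\<close> is the multiplication by scalars from \<open>'k\<close>.  Up to
  isometric isomorphism of real algebras, the instances of \<^class>\<open>real_normed_field\<close> are exactly
  \<open>real\<close> and \<open>complex\<close> (Gelfand-Mazur), so \<open>'k\<close> ranges over the usual scalar fields.
\<close>

locale banach_space_over = vector_space scale
  for scale :: "'k::real_normed_field \<Rightarrow> 'x::banach \<Rightarrow> 'x" +
  assumes norm_scale: "norm (scale k x) = norm k * norm x"
    and scale_of_real: "scale (of_real r) x = r *\<^sub>R x"

lemma banach_space_over_real:
  "banach_space_over ((*\<^sub>R) :: real \<Rightarrow> 'x::banach \<Rightarrow> 'x)"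
  by unfold_locales (simp_all add: algebra_simps)

lemma banach_space_over_complex:
  "banach_space_over ((*) :: complex \<Rightarrow> complex \<Rightarrow> complex)"
  by unfold_locales (simp_all add: algebra_simps norm_mult scaleR_conv_of_real)

definition bounded_linear_over ::
  "('k::real_normed_field \<Rightarrow> 'x::banach \<Rightarrow> 'x) \<Rightarrow> ('k \<Rightarrow> 'y::banach \<Rightarrow> 'y) \<Rightarrow> ('x \<Rightarrow> 'y) \<Rightarrow> bool"
  where "bounded_linear_over sX sY B \<longleftrightarrow>
    Vector_Spaces.linear sX sY B \<and> (\<exists>M. \<forall>x. norm (B x) \<le> M * norm x)"

definition continuous_bilinear_over ::
  "('k::real_normed_field \<Rightarrow> 'x::banach \<Rightarrow> 'x) \<Rightarrow> ('k \<Rightarrow> 'y::banach \<Rightarrow> 'y) \<Rightarrow>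
    ('x \<Rightarrow> 'x \<Rightarrow> 'y) \<Rightarrow> bool"
  where "continuous_bilinear_over sX sY A \<longleftrightarrow>
    (\<forall>x. Vector_Spaces.linear sX sY (\<lambda>y. A x y)) \<and>
    (\<forall>y. Vector_Spaces.linear sX sY (\<lambda>x. A x y)) \<and>
    continuous_on UNIV (\<lambda>(x, y). A x y)"

end

(* The iteration x' = x + h with B h = - F x and b * norm h <= norm (F x), where
   F x = A x x + B x + C, satisfies F x' = A (x + x') h.  Started at 0, it is majorized by the
   scalar iteration t' = (a * t^2 + c) / b, which increases and stays below b / (2 * a) because
   the discriminant is nonnegative.  This also covers the critical case D = 0, in which the
   convergence is not geometric. *)
theory Submission imports Defs begin

text \<open>Real scaling is scaling by \<open>of_real r\<close>, so linearity over \<open>'k\<close>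
  contains linearity over the reals. This is the bridge to the real notions
  \<open>bounded_linear\<close> and \<open>bounded_bilinear\<close>.\<close>

lemma (in banach_space_over) linear_over_scaleR:
  assumes "Vector_Spaces.linear scale s2 f" and "banach_space_over s2"
  shows "f (r *\<^sub>R x) = r *\<^sub>R f x"
proof -
  interpret f: Vector_Spaces.linear scale s2 f by fact
  show ?thesis
    using f.scale[of "of_real r" x] scale_of_real banach_space_over.scale_of_real[OF assms(2)]
    by simp
qed

lemma bounded_linear_over_imp_bounded_linear:
  assumes "banach_space_over sX" and "banach_space_over sY" and "bounded_linear_over sX sY f"
  shows "bounded_linear f"
proof -
  from assms(3) obtain M where lin: "Vector_Spaces.linear sX sY f"
    and M: "\<And>x. norm (f x) \<le> M * norm x"
    unfolding bounded_linear_over_def by blast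
  interpret f: Vector_Spaces.linear sX sY f by fact
  show ?thesis
    using f.add banach_space_over.linear_over_scaleR[OF assms(1) lin assms(2)] M
    by (intro bounded_linear_intro[where K = M]) (auto simp: mult.commute)
qed

lemma continuous_bilinear_over_imp_bounded_bilinear:
  assumes "banach_space_over sX" and "banach_space_over sY"
    and "continuous_bilinear_over sX sY A"
    and bound: "\<And>x y. norm (A x y) \<le> a * norm x * norm y"
  shows "bounded_bilinear A"
proof
  have l: "Vector_Spaces.linear sX sY (\<lambda>x. A x y)" and r: "Vector_Spaces.linear sX sY (A x)" for x y
    using assms(3) unfolding continuous_bilinear_over_def by auto
  show "A (x + x') y = A x y + A x' y" for x x' y
  proof -
    interpret f: Vector_Spaces.linear sX sY "\<lambda>x. A x y" by (fact l)
    show ?thesis by (rule f.add)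
  qed
  show "A x (y + y') = A x y + A x y'" for x y y'
  proof -
    interpret f: Vector_Spaces.linear sX sY "A x" by (fact r)
    show ?thesis by (rule f.add)
  qed
  show "A (k *\<^sub>R x) y = k *\<^sub>R A x y" for k x y
    by (rule banach_space_over.linear_over_scaleR[OF assms(1) l assms(2)])
  show "A x (k *\<^sub>R y) = k *\<^sub>R A x y" for k x y
    by (rule banach_space_over.linear_over_scaleR[OF assms(1) r assms(2)])
  show "\<exists>K. \<forall>x y. norm (A x y) \<le> norm x * norm y * K"
    using bound by (intro exI[of _ a]) (simp add: ac_simps)
qed

text \<open>Stretch a nonzero \<open>y\<close> to norm \<open>b\<close>, take a preimage in the unit
  ball and scale it back by \<open>norm y / b\<close>. The function \<open>g\<close> collects such
  preimages, chosen point by point.\<close>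

lemma ball_image_imp_bounded_right_inverse:
  fixes B :: "'x::real_normed_vector \<Rightarrow> 'y::real_normed_vector"
  assumes "linear B" and "b > 0" and "cball 0 b \<subseteq> B ` cball 0 1"
  obtains g where "\<And>y. B (g y) = y" and "\<And>y. norm (g y) \<le> norm y / b"
proof -
  interpret B: linear B by fact
  have "\<exists>x. B x = y \<and> norm x \<le> norm y / b" for y
  proof (cases "y = 0")
    case True
    then show ?thesis by (intro exI[of _ 0]) simp
  next
    case False
    have "(b / norm y) *\<^sub>R y \<in> cball 0 b"
      using False \<open>b > 0\<close> by simp
    with assms(3) obtain u where u: "B u = (b / norm y) *\<^sub>R y" "norm u \<le> 1"
      by (metis (no_types, lifting) image_iff mem_cball_0 subsetD)
    have "B ((norm y / b) *\<^sub>R u) = y"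
      using u(1) False \<open>b > 0\<close> by (simp add: B.scaleR)
    moreover have "norm ((norm y / b) *\<^sub>R u) \<le> norm y / b"
      using u(2) \<open>b > 0\<close> by (simp add: mult_left_le divide_right_mono)
    ultimately show ?thesis by blast
  qed
  then show thesis using that by metis
qed

text \<open>For nonzero \<open>b\<close>, the fixed points of this iteration are the roots of
  \<open>a * t^2 - b * t + c = 0\<close>, whose discriminant is the \<open>D\<close> of the
  theorem.\<close>

primrec majorant :: "real \<Rightarrow> real \<Rightarrow> real \<Rightarrow> nat \<Rightarrow> real" where
  "majorant a b c 0 = 0"
| "majorant a b c (Suc n) = (a * (majorant a b c n)\<^sup>2 + c) / b"

lemma majorant_nonneg:
  assumes "a \<ge> 0" "b > 0" "c \<ge> 0"
  shows "majorant a b c n \<ge> 0"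
  by (induction n) (use assms in auto)

lemma majorant_mono_Suc:
  assumes "a \<ge> 0" "b > 0" "c \<ge> 0"
  shows "majorant a b c n \<le> majorant a b c (Suc n)"
proof (induction n)
  case 0
  show ?case using assms by simp
next
  case (Suc n)
  have "(majorant a b c n)\<^sup>2 \<le> (majorant a b c (Suc n))\<^sup>2"
    using Suc majorant_nonneg[OF assms] by (rule power_mono)
  then have "(a * (majorant a b c n)\<^sup>2 + c) / b \<le> (a * (majorant a b c (Suc n))\<^sup>2 + c) / b"
    using assms by (intro divide_right_mono add_mono mult_left_mono) auto
  then show ?case by (simp only: majorant.simps)
qed

text \<open>For \<open>a > 0\<close> the value \<open>b / (2 * a)\<close> is the vertex of the
  parabola \<open>a * t^2 - b * t + c\<close>. The discriminant condition makes the iteration map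
  send the interval from 0 to the vertex into itself.\<close>

lemma majorant_le:
  assumes "a > 0" "b > 0" "c \<ge> 0" "4 * a * c \<le> b\<^sup>2"
  shows "majorant a b c n \<le> b / (2 * a)"
proof (induction n)
  case 0
  show ?case using assms by simp
next
  case (Suc n)
  \<comment> \<open>Each of the two summands on the right equals
    \<open>b^2 / (4 * a)\<close>.\<close>
  have "a * (majorant a b c n)\<^sup>2 + c \<le> a * (b / (2 * a))\<^sup>2 + b\<^sup>2 / (4 * a)"
  proof (intro add_mono mult_left_mono power_mono Suc)
    show "c \<le> b\<^sup>2 / (4 * a)"
      using assms by (simp add: field_simps)
  qed (use assms majorant_nonneg[of a b c] in auto)
  also have "\<dots> = b * (b / (2 * a))"
    using \<open>a > 0\<close> by (simp add: field_simps power2_eq_square)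
  finally show ?case
    using \<open>b > 0\<close> by (simp add: pos_divide_le_eq mult.commute)
qed

lemma convergent_majorant:
  assumes "a > 0" "b > 0" "c \<ge> 0" "4 * a * c \<le> b\<^sup>2"
  shows "convergent (majorant a b c)"
proof (rule Bseq_monoseq_convergent)
  show "monoseq (majorant a b c)"
    using majorant_mono_Suc[of a b c] assms by (simp add: monoseq_Suc del: majorant.simps)
  have "\<bar>majorant a b c n\<bar> \<le> b / (2 * a)" for n
    using majorant_nonneg[of a b c n] majorant_le[OF assms, of n] assms by simp
  then show "Bseq (majorant a b c)"
    by (intro BseqI'[where K = "b / (2 * a)"]) simp
qed

text \<open>The increments of \<open>t\<close> telescope to a convergent series and dominate those
  of \<open>x\<close>, so the increments of \<open>x\<close> are summable by completeness.\<close>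

lemma majorized_sequence_convergent:
  fixes x :: "nat \<Rightarrow> 'x::banach"
  assumes "\<And>n. norm (x (Suc n) - x n) \<le> t (Suc n) - t n" and "convergent t"
  shows "convergent x"
proof -
  from assms(2) have "summable (\<lambda>n. t (Suc n) - t n)"
    by (auto simp: convergent_def intro: telescope_summable)
  then have "summable (\<lambda>n. x (Suc n) - x n)"
    using assms(1) by (rule summable_comparison_test'[where N = 0])
  then have "convergent (\<lambda>n. x n - x 0)"
    by (simp add: summable_iff_convergent sum_lessThan_telescope)
  then show ?thesis
    by (simp add: convergent_diff_const_right_iff)
qed

lemma quadratic_equation_solvable:
  fixes A :: "'x::banach \<Rightarrow> 'x \<Rightarrow> 'y::banach"
  assumes "bounded_bilinear A" and "bounded_linear B"
    and bound: "\<And>x y. norm (A x y) \<le> a * norm x * norm y"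
    and sym: "\<And>x y. A x y = A y x"
    and pos: "a > 0" "b > 0"
    and ball: "cball 0 b \<subseteq> B ` cball 0 1"
    and discr: "4 * a * norm C \<le> b\<^sup>2"
  shows "\<exists>x. A x x + B x + C = 0"
proof -
  interpret A: bounded_bilinear A by fact
  interpret B: bounded_linear B by fact
  define F where "F x = A x x + B x + C" for x
  obtain g where Bg: "\<And>y. B (g y) = y" and norm_g: "\<And>y. norm (g y) \<le> norm y / b"
    using ball_image_imp_bounded_right_inverse[OF B.linear pos(2) ball] by blast
  define t where "t = majorant a b (norm C)"
  \<comment> \<open>A simplified Newton method: \<open>B\<close> is the derivative of
    \<open>F\<close> at 0 and is kept fixed, with \<open>g\<close> selecting a solution of the
    linearized equation.\<close>
  define x where "x = rec_nat 0 (\<lambda>_ x. x + g (- F x))"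
  have x0: "x 0 = 0" and xS: "\<And>n. x (Suc n) = x n + g (- F (x n))"
    by (simp_all add: x_def)
  have t0: "t 0 = 0" and tS: "b * t (Suc n) = a * (t n)\<^sup>2 + norm C" for n
    using pos by (simp_all add: t_def)
  have t_mono: "t n \<le> t (Suc n)" for n
    using pos unfolding t_def by (intro majorant_mono_Suc) auto
  have step: "norm (x (Suc n) - x n) \<le> norm (F (x n)) / b" for n
    using norm_g[of "- F (x n)"] by (simp add: xS)
  \<comment> \<open>The correction gives \<open>B (x (Suc n)) + C = - A (x n) (x n)\<close>. What
    remains is a difference of squares, which factors by the symmetry of \<open>A\<close>.\<close>
  have FS: "F (x (Suc n)) = A (x n + x (Suc n)) (x (Suc n) - x n)" for n
  proof -
    have "B (x (Suc n)) = B (x n) - F (x n)"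
      by (simp add: xS B.add Bg)
    then have "F (x (Suc n)) = A (x (Suc n)) (x (Suc n)) - A (x n) (x n)"
      by (simp add: F_def)
    also have "\<dots> = A (x n + x (Suc n)) (x (Suc n) - x n)"
      by (simp add: A.add_left A.diff_right sym[of "x (Suc n)" "x n"])
    finally show ?thesis .
  qed
  \<comment> \<open>The bound \<open>b * (t (Suc n) - t n)\<close> is the scalar residual
    \<open>a * t^2 - b * t + norm C\<close> at \<open>t n\<close>. The residual bound controls the
    next step, and the norm bound controls the factor \<open>x n + x (Suc n)\<close> in
    \<open>FS\<close>.\<close>
  have inv: "norm (x n) \<le> t n \<and> norm (F (x n)) \<le> b * (t (Suc n) - t n)" for n
  proof (induction n)
    case 0
    show ?case using tS[of 0] by (simp add: x0 t0 F_def A.zero_left B.zero)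
  next
    case (Suc n)
    have h: "norm (x (Suc n) - x n) \<le> t (Suc n) - t n"
      using step[of n] Suc pos by (smt (verit) pos_divide_le_eq mult.commute)
    have xt: "norm (x (Suc n)) \<le> t (Suc n)"
      using h Suc norm_triangle_sub[of "x (Suc n)" "x n"] by linarith
    have "norm (F (x (Suc n))) \<le> a * norm (x n + x (Suc n)) * norm (x (Suc n) - x n)"
      unfolding FS by (rule bound)
    also have "\<dots> \<le> a * (t n + t (Suc n)) * (t (Suc n) - t n)"
    proof (intro mult_mono order.refl h)
      show "norm (x n + x (Suc n)) \<le> t n + t (Suc n)"
        using xt Suc by (intro norm_triangle_mono) auto
      then show "0 \<le> a * (t n + t (Suc n))"
        using pos norm_ge_zero[of "x n + x (Suc n)"] by (intro mult_nonneg_nonneg) linarith+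
    qed (use pos in auto)
    \<comment> \<open>The product is \<open>a\<close> times the difference of the squares of
      \<open>t (Suc n)\<close> and \<open>t n\<close>; in the difference of two instances of
      \<open>tS\<close> the constant \<open>norm C\<close> cancels.\<close>
    also have "\<dots> = b * (t (Suc (Suc n)) - t (Suc n))"
      unfolding right_diff_distrib tS by (simp add: algebra_simps power2_eq_square)
    finally show ?case using xt by simp
  qed
  have "norm (x (Suc n) - x n) \<le> t (Suc n) - t n" for n
    using step[of n] inv[of n] pos by (smt (verit) pos_divide_le_eq mult.commute)
  moreover have t_conv: "convergent t"
    unfolding t_def using pos discr by (intro convergent_majorant) auto
  ultimately have "convergent x"
    by (rule majorized_sequence_convergent)
  then obtain l where l: "x \<longlonglongrightarrow> l"
    by (auto simp: convergent_def)
  have "(\<lambda>n. F (x n)) \<longlonglongrightarrow> F l"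
    unfolding F_def by (intro tendsto_intros A.tendsto B.tendsto l)
  \<comment> \<open>The residuals are squeezed by increments of the convergent sequence
    \<open>t\<close>.\<close>
  moreover have "(\<lambda>n. F (x n)) \<longlonglongrightarrow> 0"
  proof (rule Lim_null_comparison)
    show "\<forall>\<^sub>F n in sequentially. norm (F (x n)) \<le> b * (t (Suc n) - t n)"
      using inv by simp
    obtain T where T: "t \<longlonglongrightarrow> T"
      using t_conv by (auto simp: convergent_def)
    have "(\<lambda>n. b * (t (Suc n) - t n)) \<longlonglongrightarrow> b * (T - T)"
      by (intro tendsto_intros T LIMSEQ_Suc[OF T])
    then show "(\<lambda>n. b * (t (Suc n) - t n)) \<longlonglongrightarrow> 0" by simp
  qed
  ultimately have "F l = 0"
    by (rule LIMSEQ_unique)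
  then show ?thesis
    unfolding F_def by blast
qed

theorem proposition1:
  fixes sX :: "'k::real_normed_field \<Rightarrow> 'x::banach \<Rightarrow> 'x"
    and sY :: "'k \<Rightarrow> 'y::banach \<Rightarrow> 'y"
    and A :: "'x \<Rightarrow> 'x \<Rightarrow> 'y" and B :: "'x \<Rightarrow> 'y" and C :: 'y
    and a b c D :: real
  assumes "banach_space_over sX" and "banach_space_over sY"
    and "continuous_bilinear_over sX sY A"
    and "\<And>x1 x2. norm (A x1 x2) \<le> a * norm x1 * norm x2"
    and "\<And>x1 x2. A x1 x2 = A x2 x1"
    and "bounded_linear_over sX sY B" and "surj B"
    and "b > 0" and "cball 0 b \<subseteq> B ` cball 0 1"
    and "c = norm C" and "D = b\<^sup>2 - 4 * a * c" and "D \<ge> 0"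
  shows "\<exists>x. A x x + B x + C = 0"
proof (cases "a > 0")
  case True
  show ?thesis
  proof (rule quadratic_equation_solvable[where A = A and B = B and C = C and a = a and b = b])
    show "bounded_bilinear A"
      by (rule continuous_bilinear_over_imp_bounded_bilinear[OF assms(1-4)])
    show "bounded_linear B"
      by (rule bounded_linear_over_imp_bounded_linear[OF assms(1,2,6)])
    show "4 * a * norm C \<le> b\<^sup>2"
      using assms(10-12) by simp
  qed (fact True assms)+
next
  case False
  have "A x x = 0" for x
  proof -
    have "a * norm x * norm x \<le> 0"
      using False by (simp add: mult.assoc mult_nonpos_nonneg)
    with assms(4)[of x x] show ?thesis
      by (meson norm_le_zero_iff order.trans)
  qed
  moreover obtain x where "B x = - C"
    using \<open>surj B\<close> by (metis surjD)
  ultimately show ?thesis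
    by (intro exI[of _ x]) simp
qed

end
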